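(* Let $(\mathbb{X}, d, \Sigma, \mu)$ be a metric measure space of dimension $D>0$ (with constants $c_D,\rho>0$). Suppose $P$ is a probability measure on $(\mathbb{X},\Sigma)$, absolutely continuous with respect to $\mu$, with full dimension on $\mathcal{X} \subseteq \mathbb{X}$ (with functions $\gamma_*,\gamma^*:\mathcal{X}\to(0,\infty)$) and density function $p : \mathcal{X} \to [0,\infty)$. Let $k \le n$ be positive integers, let $X_1,\dots,X_n$ be IID samples from $P$, and let $x \in \mathcal{X}$ be a point at which the full-dimension inequalities hold. Write $\gamma_*=\gamma_*(x)$ and $\gamma^*=\gamma^*(x)$. If $r \in \left[\left(\frac{k}{\gamma_* n}\right)^{1/D}, \rho\right]$, then \[\mathbb{P}\left[\varepsilon_k(x) > r\right] \leq e^{-\gamma_* r^D n}\left(e\,\frac{\gamma_* r^D n}{k}\right)^k,\] and, if $r \in \left[0, \min\left\{\left(\frac{k}{\gamma^* n}\right)^{1/D}, \rho\right\}\right]$, then \[\mathbb{P}\left[\varepsilon_k(x) \leq r\right] \leq \left(\frac{e\gamma^* r^D n}{k}\right)^{k\gamma_*/\gamma^*}.\]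
   Context: A metric measure space is a quadruple $(\mathbb{X}, d, \Sigma, \mu)$ where $\mathbb{X}$ is a set, $d$ is a metric on $\mathbb{X}$, $\Sigma$ is a $\sigma$-algebra on $\mathbb{X}$ containing the Borel $\sigma$-algebra induced by $d$, and $\mu:\Sigma\to[0,\infty]$ is a $\sigma$-finite measure. $B(x,r)=\{y : d(x,y)<r\}$ is the open ball. The space has dimension $D$ if there exist constants $c_D,\rho>0$ such that $\mu(B(x,r)) = c_D r^D$ for all $r\in[0,\rho]$ and all $x$. A measure $P$ on $(\mathbb{X},\Sigma)$ has full dimension on a set $\mathcal{X}\subseteq\mathbb{X}$ if there exist functions $\gamma_*,\gamma^*:\mathcal{X}\to(0,\infty)$ such that, for all $r\in[0,\rho]$ and $\mu$-almost all $x\in\mathcal{X}$, $\gamma_*(x) r^D \le P(B(x,r)) \le \gamma^*(x) r^D$ (the "full-dimension inequalities" at $x$). $P$ is carried by $\mathcal{X}$, with density $p$ with respect to $\mu$. For $x\in\mathcal{X}$, $\varepsilon_k(x)$ denotes the distance $d(x,X_i)$ from $x$ to its $k$-th nearest neighbor $X_i$ in $\{X_1,\dots,X_n\}$.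
   Formalization: The second bound at the endpoint r = ρ is proved only if P gives measure zero to the sphere {y : d(x,y) = ρ}; without this it can fail, since the full-dimension inequalities control only open balls of radius at most ρ. For r < ρ nothing is added. *)

theory Defs
  imports "HOL-Probability.Probability"
begin

locale metric_measure_space = sigma_finite_measure \<mu>
  for \<mu> :: "'a::metric_space measure" +
  assumes space_eq_UNIV: "space \<mu> = UNIV"
    and borel_subset_sets: "sets borel \<subseteq> sets \<mu>"

text \<open>The exponent \<open>D\<close> is real. For \<open>D > 0\<close>, the convention \<open>0 powr D = 0\<close> of the library agrees
  with \<open>0\<^sup>D = 0\<close>, so \<open>r = 0\<close> is included with its usual meaning.\<close>

definition has_dimension :: "'a::metric_space measure \<Rightarrow> real \<Rightarrow> real \<Rightarrow> real \<Rightarrow> bool" where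
  "has_dimension \<mu> D c \<rho> \<longleftrightarrow> c > 0 \<and> \<rho> > 0 \<and>
     (\<forall>r\<in>{0..\<rho>}. \<forall>x. emeasure \<mu> (ball x r) = ennreal (c * r powr D))"

definition full_dimension_ineqs ::
    "'a::metric_space measure \<Rightarrow> real \<Rightarrow> real \<Rightarrow> ('a \<Rightarrow> real) \<Rightarrow> ('a \<Rightarrow> real) \<Rightarrow> 'a \<Rightarrow> bool" where
  "full_dimension_ineqs P D \<rho> \<gamma>\<^sub>l \<gamma>\<^sub>u x \<longleftrightarrow>
     (\<forall>r\<in>{0..\<rho>}. \<gamma>\<^sub>l x * r powr D \<le> measure P (ball x r) \<and> measure P (ball x r) \<le> \<gamma>\<^sub>u x * r powr D)"

definition full_dimension_on ::
    "'a::metric_space measure \<Rightarrow> 'a measure \<Rightarrow> real \<Rightarrow> real \<Rightarrow> 'a set \<Rightarrow> ('a \<Rightarrow> real) \<Rightarrow> ('a \<Rightarrow> real) \<Rightarrow> bool" where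
  "full_dimension_on \<mu> P D \<rho> S \<gamma>\<^sub>l \<gamma>\<^sub>u \<longleftrightarrow>
     (\<forall>x\<in>S. \<gamma>\<^sub>l x > 0 \<and> \<gamma>\<^sub>u x > 0) \<and>
     (AE x in \<mu>. x \<in> S \<longrightarrow> full_dimension_ineqs P D \<rho> \<gamma>\<^sub>l \<gamma>\<^sub>u x)"

text \<open>A density given only on \<open>S\<close> is extended by zero outside \<open>S\<close>; in particular \<open>P\<close> is carried
  by \<open>S\<close>. The set \<open>S\<close> itself need not be measurable.\<close>

definition has_density_on ::
    "'a measure \<Rightarrow> 'a measure \<Rightarrow> 'a set \<Rightarrow> ('a \<Rightarrow> real) \<Rightarrow> bool" where
  "has_density_on \<mu> P S p \<longleftrightarrow>
     (\<forall>y\<in>S. p y \<ge> 0) \<and>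
     (\<lambda>y. p y * indicator S y) \<in> borel_measurable \<mu> \<and>
     P = density \<mu> (\<lambda>y. ennreal (p y * indicator S y))"

text \<open>The distance from \<open>x\<close> to its \<open>k\<close>-th nearest neighbour among \<open>X 1, \<dots>, X n\<close> is the \<open>k\<close>-th
  smallest of the \<open>n\<close> distances, counted with multiplicity; it does not depend on how ties
  are broken. It is meaningful for \<open>1 \<le> k \<le> n\<close>.\<close>

definition knn_dist :: "nat \<Rightarrow> nat \<Rightarrow> (nat \<Rightarrow> 'a::metric_space) \<Rightarrow> 'a \<Rightarrow> real" where
  "knn_dist k n X x = sort (map (\<lambda>i. dist x (X i)) [1..<n+1]) ! (k - 1)"

end

theory Submission imports Defs begin

text \<open>The number \<open>N\<close> of samples in a ball \<open>A\<close> about \<open>x\<close> is binomial, and \<open>\<epsilon>\<^sub>k(x) \<le> r\<close> means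
  that at least \<open>k\<close> samples lie in the closed ball of radius \<open>r\<close>. Both bounds are Chernoff bounds:
  \<open>\<bbbE>[t\<^sup>N] = (1 + P(A)(t - 1))\<^sup>n \<le> exp(n P(A)(t - 1))\<close>, and Markov's inequality is
  applied with \<open>t = k / (\<gamma>\<^sub>* r\<^sup>D n) \<le> 1\<close> for the first and \<open>t = k / (\<gamma>\<^sup>* r\<^sup>D n) \<ge> 1\<close> for the
  second bound. The second one comes out with exponent \<open>k\<close>, which may be lowered to
  \<open>k \<gamma>\<^sub>* / \<gamma>\<^sup>*\<close>, since \<open>\<gamma>\<^sub>* \<le> \<gamma>\<^sup>*\<close> and a probability is at most 1.\<close>

section \<open>Order statistics and counts of points in closed balls\<close>

text \<open>In a sorted list the entries not exceeding \<open>r\<close> form a prefix, so only the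
  length of that prefix matters.\<close>

lemma sorted_nth_le_iff_less_length_filter:
  fixes ys :: "'b::linorder list"
  assumes "sorted ys" "j < length ys"
  shows "ys ! j \<le> r \<longleftrightarrow> j < length (filter (\<lambda>y. y \<le> r) ys)"
  using assms
proof (induction ys arbitrary: j)
  case (Cons y ys)
  show ?case
  proof (cases "y \<le> r")
    case True
    then show ?thesis using Cons by (cases j) auto
  next
    case False
    then have "filter (\<lambda>y. y \<le> r) (y # ys) = []"
      using Cons.prems by (auto simp: filter_empty_conv)
    moreover have "y \<le> (y # ys) ! j"
      using Cons.prems by (cases j) auto
    ultimately show ?thesis using False by auto
  qed
qed simp

lemma knn_dist_le_iff:
  assumes "1 \<le> k" "k \<le> n"
  shows "knn_dist k n X x \<le> r \<longleftrightarrow> k \<le> card {i\<in>{1..n}. X i \<in> cball x r}"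
proof -
  let ?f = "\<lambda>i. dist x (X i)"
  let ?xs = "map ?f [1..<n+1]"
  \<comment> \<open>Indices start at 0, so \<open>k \<le> n\<close> keeps \<open>k - 1\<close>
    inside the list, and \<open>1 \<le> k\<close> later turns \<open>k - 1 < m\<close> into
    \<open>k \<le> m\<close>.\<close>
  have "knn_dist k n X x \<le> r \<longleftrightarrow> k - 1 < length (filter (\<lambda>y. y \<le> r) (sort ?xs))"
    unfolding knn_dist_def using assms
    by (intro sorted_nth_le_iff_less_length_filter) auto
  also have "length (filter (\<lambda>y. y \<le> r) (sort ?xs)) = length (filter (\<lambda>y. y \<le> r) ?xs)"
    by (metis mset_filter mset_sort size_mset)
  also have "\<dots> = length (filter (\<lambda>i. ?f i \<le> r) [1..<n+1])"
    by (simp add: filter_map o_def)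
  also have "\<dots> = card (set (filter (\<lambda>i. ?f i \<le> r) [1..<n+1]))"
    by (intro distinct_card[symmetric]) simp
  also have "set (filter (\<lambda>i. ?f i \<le> r) [1..<n+1]) = {i\<in>{1..n}. X i \<in> cball x r}"
    by auto
  finally show ?thesis using assms by auto
qed

section \<open>Chernoff bounds for the number of samples in a set\<close>

context prob_space
begin

text \<open>The power is a product over \<open>i\<close> of factors equal to \<open>t\<close> if the
  sample hits \<open>A\<close> and to 1 otherwise; independence lets the expectation pass through
  the product.\<close>

lemma expectation_power_card:
  fixes t :: real
  assumes "finite I" and ind: "indep_vars (\<lambda>_. N) X I" and A: "A \<in> sets N"
    and q: "\<And>i. i \<in> I \<Longrightarrow> measure (distr M N (X i)) A = q"
  shows "integrable M (\<lambda>\<omega>. t ^ card {i\<in>I. X i \<omega> \<in> A})"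
    and "expectation (\<lambda>\<omega>. t ^ card {i\<in>I. X i \<omega> \<in> A}) = (1 + q * (t - 1)) ^ card I"
proof -
  let ?g = "\<lambda>y. 1 + (t - 1) * indicator A y :: real"
  have meas: "X i \<in> measurable M N" if "i \<in> I" for i
    using ind that by (auto simp: indep_vars_def)
  have g: "?g \<in> borel_measurable N" using A by measurable
  have ind': "indep_vars (\<lambda>_. borel) (\<lambda>i \<omega>. ?g (X i \<omega>)) I"
    using indep_vars_compose2[OF ind, of "\<lambda>_. ?g" "\<lambda>_. borel"] g by simp
  have int: "integrable M (\<lambda>\<omega>. indicator A (X i \<omega>) :: real)" if "i \<in> I" for i
    using meas[OF that] A by (intro integrable_const_bound[where B = 1]) auto
  have eq: "t ^ card {i\<in>I. X i \<omega> \<in> A} = (\<Prod>i\<in>I. ?g (X i \<omega>))" for \<omega>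
  proof -
    have "(\<Prod>i\<in>I. ?g (X i \<omega>)) = (\<Prod>i\<in>I. if X i \<omega> \<in> A then t else 1)"
      by (intro prod.cong) auto
    also have "\<dots> = t ^ card {i\<in>I. X i \<omega> \<in> A}"
      using \<open>finite I\<close> by (simp add: prod.If_cases Int_def)
    finally show ?thesis by simp
  qed
  have mean: "expectation (\<lambda>\<omega>. ?g (X i \<omega>)) = 1 + q * (t - 1)" if "i \<in> I" for i
  proof -
    have "expectation (\<lambda>\<omega>. indicator A (X i \<omega>) :: real) = (\<integral>y. indicator A y \<partial>distr M N (X i))"
      using A meas[OF that] by (subst integral_distr) auto
    also have "\<dots> = q"
      using A q[OF that] sets.sets_into_space[OF A] by (simp add: Int_absorb2)
    finally show ?thesis
      using int[OF that] by (simp add: prob_space mult.commute)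
  qed
  have int': "integrable M (\<lambda>\<omega>. ?g (X i \<omega>))" if "i \<in> I" for i
    using int[OF that] by simp
  show "integrable M (\<lambda>\<omega>. t ^ card {i\<in>I. X i \<omega> \<in> A})"
    unfolding eq by (rule indep_vars_integrable[OF \<open>finite I\<close> ind' int'])
  show "expectation (\<lambda>\<omega>. t ^ card {i\<in>I. X i \<omega> \<in> A}) = (1 + q * (t - 1)) ^ card I"
    unfolding eq using indep_vars_lebesgue_integral[OF \<open>finite I\<close> ind' int'] by (simp add: mean)
qed

text \<open>Markov's inequality combined with \<open>1 + u \<le> exp u\<close>. The event compares
  powers instead of counts, so that one bound serves both tails, with \<open>t \<le> 1\<close> and
  with \<open>t \<ge> 1\<close>.\<close>

lemma prob_power_card_ge_le:
  fixes t c :: real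
  assumes "finite I" and "indep_vars (\<lambda>_. N) X I" and "A \<in> sets N"
    and q: "\<And>i. i \<in> I \<Longrightarrow> measure (distr M N (X i)) A = q"
    and "t \<ge> 0" "c > 0" and q1: "0 \<le> q" "q \<le> 1"
  shows "prob {\<omega>\<in>space M. c \<le> t ^ card {i\<in>I. X i \<omega> \<in> A}} \<le> exp (real (card I) * q * (t - 1)) / c"
proof -
  \<comment> \<open>The base equals \<open>(1 - q) + q * t\<close>; monotonicity of powers requires
    it to be nonnegative.\<close>
  have "0 \<le> q * t" using q1 \<open>t \<ge> 0\<close> by simp
  then have "0 \<le> 1 + q * (t - 1)" using q1 unfolding right_diff_distrib by linarith
  then have "(1 + q * (t - 1)) ^ card I \<le> exp (q * (t - 1)) ^ card I"
    by (intro power_mono exp_ge_add_one_self) auto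
  also have "\<dots> = exp (real (card I) * q * (t - 1))"
    by (simp add: exp_of_nat_mult[symmetric] mult.assoc)
  finally have le: "(1 + q * (t - 1)) ^ card I / c \<le> exp (real (card I) * q * (t - 1)) / c"
    using \<open>c > 0\<close> by (simp add: divide_right_mono)
  have "prob {\<omega>\<in>space M. c \<le> t ^ card {i\<in>I. X i \<omega> \<in> A}}
      \<le> expectation (\<lambda>\<omega>. t ^ card {i\<in>I. X i \<omega> \<in> A}) / c"
    using \<open>t \<ge> 0\<close> \<open>c > 0\<close>
    by (intro integral_Markov_inequality_measure[where A = "{}"] expectation_power_card(1)[OF assms(1-4)]) auto
  also have "\<dots> = (1 + q * (t - 1)) ^ card I / c"
    by (subst expectation_power_card(2)[OF assms(1-4)]) auto
  finally show ?thesis using le by linarith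
qed

lemma card_in_measurable:
  assumes "finite I" and ind: "indep_vars (\<lambda>_. N) X I" and A: "A \<in> sets N"
  shows "{\<omega>\<in>space M. Q (card {i\<in>I. X i \<omega> \<in> A})} \<in> events"
proof -
  have meas: "X i \<in> measurable M N" if "i \<in> I" for i
    using ind that by (auto simp: indep_vars_def)
  have eq: "card {i\<in>I. X i \<omega> \<in> A} = (\<Sum>i\<in>I. if X i \<omega> \<in> A then 1 else 0)" for \<omega>
    using \<open>finite I\<close> by (simp add: sum.If_cases Int_def)
  have [measurable]: "(\<lambda>\<omega>. (\<Sum>i\<in>I. if X i \<omega> \<in> A then 1 else (0::nat))) \<in> measurable M (count_space UNIV)"
  proof (rule measurable_sum_nat)
    fix i assume "i \<in> I"
    note [measurable] = meas[OF this] A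
    show "(\<lambda>\<omega>. if X i \<omega> \<in> A then 1 else (0::nat)) \<in> measurable M (count_space UNIV)"
      by measurable
  qed
  show ?thesis unfolding eq by measurable
qed

lemma prob_card_less_le:
  assumes "finite I" and "indep_vars (\<lambda>_. N) X I" and "A \<in> sets N"
    and "\<And>i. i \<in> I \<Longrightarrow> measure (distr M N (X i)) A = q"
    and q1: "q \<le> 1" and a: "0 < a" "a \<le> q" and k: "0 < k" "real k \<le> a * card I"
  shows "prob {\<omega>\<in>space M. card {i\<in>I. X i \<omega> \<in> A} < k}
           \<le> exp (- (a * card I)) * (exp 1 * (a * card I / k)) ^ k"
proof -
  \<comment> \<open>This \<open>t\<close> minimises
    \<open>exp (a * card I * (t - 1)) / t ^ k\<close>. As \<open>t \<le> 1\<close>, a smaller count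
    gives a larger power.\<close>
  define t where "t = real k / (a * card I)"
  have pos: "0 < a * card I" using k by linarith
  have t: "0 < t" "t \<le> 1" using pos k by (auto simp: t_def)
  have "prob {\<omega>\<in>space M. card {i\<in>I. X i \<omega> \<in> A} < k}
      \<le> prob {\<omega>\<in>space M. t ^ k \<le> t ^ card {i\<in>I. X i \<omega> \<in> A}}"
    using t by (intro finite_measure_mono card_in_measurable[OF assms(1-3)]) (auto intro!: power_decreasing)
  also have "\<dots> \<le> exp (real (card I) * q * (t - 1)) / t ^ k"
    using t a q1 by (intro prob_power_card_ge_le[OF assms(1-4)]) auto
  \<comment> \<open>Since \<open>t - 1 \<le> 0\<close>, replacing \<open>q\<close> by its lower
    bound \<open>a\<close> increases the exponent.\<close>
  also have "real (card I) * q * (t - 1) \<le> real (card I) * a * (t - 1)"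
    using t a by (intro mult_right_mono_neg mult_left_mono) auto
  then have "exp (real (card I) * q * (t - 1)) / t ^ k \<le> exp (real (card I) * a * (t - 1)) / t ^ k"
    using t by (simp add: divide_right_mono)
  also have "real (card I) * a * (t - 1) = real k * 1 - a * card I"
    using pos by (auto simp: t_def field_simps)
  also have "exp (real k * 1 - a * card I) / t ^ k = exp (- (a * card I)) * (exp 1 * (a * card I / k)) ^ k"
    unfolding exp_diff exp_of_nat_mult t_def power_mult_distrib power_divide exp_minus
    by (simp add: divide_inverse mult_ac)
  finally show ?thesis .
qed

text \<open>The parameter \<open>t\<close> stays free in \<open>chernoff\<close>, because the
  minimiser \<open>k / (b * card I)\<close> exists only when \<open>b * card I\<close> is
  nonzero.\<close>

lemma prob_card_ge_le:
  assumes "finite I" and "indep_vars (\<lambda>_. N) X I" and "A \<in> sets N"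
    and "\<And>i. i \<in> I \<Longrightarrow> measure (distr M N (X i)) A = q"
    and q: "0 \<le> q" "q \<le> 1" "q \<le> b" and k: "0 < k" "b * card I \<le> real k"
  shows "prob {\<omega>\<in>space M. k \<le> card {i\<in>I. X i \<omega> \<in> A}} \<le> (exp 1 * (b * card I / k)) ^ k"
proof -
  let ?E = "{\<omega>\<in>space M. k \<le> card {i\<in>I. X i \<omega> \<in> A}}"
  have chernoff: "prob ?E \<le> exp (b * card I * (t - 1)) / t ^ k" if t: "1 \<le> t" for t
  proof -
    have "prob ?E \<le> prob {\<omega>\<in>space M. t ^ k \<le> t ^ card {i\<in>I. X i \<omega> \<in> A}}"
      using t expectation_power_card(1)[OF assms(1-4), THEN borel_measurable_integrable]
      by (intro finite_measure_mono) (auto intro!: power_increasing)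
    also have "\<dots> \<le> exp (real (card I) * q * (t - 1)) / t ^ k"
      using t q by (intro prob_power_card_ge_le[OF assms(1-4)]) auto
    also have "real (card I) * q * (t - 1) \<le> b * card I * (t - 1)"
      using t q by (subst mult.commute[of b]) (intro mult_right_mono mult_left_mono, auto)
    then have "exp (real (card I) * q * (t - 1)) / t ^ k \<le> exp (b * card I * (t - 1)) / t ^ k"
      using t by (simp add: divide_right_mono)
    finally show ?thesis .
  qed
  show ?thesis
  proof (cases "b * card I = 0")
    case True
    txt \<open>Here the optimal \<open>t\<close> is infinite, so a large finite one has to do.\<close>
    have "prob ?E = 0"
    proof (rule ccontr)
      assume "prob ?E \<noteq> 0"
      then have p: "prob ?E > 0" by (simp add: zero_less_measure_iff)
      \<comment> \<open>Chosen so that the bound \<open>1 / t\<close> is half of the positive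
        probability it should dominate.\<close>
      define t where "t = 2 / prob ?E"
      have t: "1 \<le> t" using p prob_le_1[of ?E] unfolding t_def
        by (simp add: le_divide_eq del: prob_le_1)
      have "prob ?E \<le> 1 / t ^ k" using chernoff[OF t] True by simp
      also have "\<dots> \<le> 1 / t"
        using t k self_le_power[of t k] by (intro divide_left_mono) auto
      also have "\<dots> = prob ?E / 2" by (simp add: t_def)
      finally show False using p by simp
    qed
    then show ?thesis unfolding True using k by simp
  next
    case False
    moreover have "0 \<le> b * card I" using q by simp
    ultimately have pos: "0 < b * card I" by linarith
    define t where "t = real k / (b * card I)"
    have t: "1 \<le> t" using pos k by (simp add: t_def)
    have "prob ?E \<le> exp (b * card I * (t - 1)) / t ^ k" by (rule chernoff[OF t])
    \<comment> \<open>The exponent is \<open>k - b * card I\<close>; the factor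
      \<open>exp (- (b * card I))\<close>, which is at most 1, is given away.\<close>
    also have "\<dots> \<le> exp (real k * 1) / t ^ k"
    proof (intro divide_right_mono)
      have "b * card I * t = real k"
        using False by (auto simp: t_def)
      then have "b * card I * (t - 1) \<le> real k * 1" using pos unfolding right_diff_distrib by linarith
      then show "exp (b * card I * (t - 1)) \<le> exp (real k * 1)" by simp
    qed (use t in simp)
    also have "\<dots> = (exp 1 * (b * card I / k)) ^ k"
      unfolding exp_of_nat_mult by (simp add: t_def power_divide power_mult_distrib)
    finally show ?thesis .
  qed
qed

end

section \<open>From open to closed balls\<close>

text \<open>For \<open>r < \<rho>\<close> the closed ball lies in every open ball of radius
  \<open>s\<close> with \<open>r < s < \<rho>\<close>, and \<open>s\<close> tends to
  \<open>r\<close> from the right. At \<open>r = \<rho>\<close> no larger radius is available, so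
  there the sphere must be null.\<close>

lemma full_dimension_ineqs_cball_le:
  assumes "prob_space P" and bs: "sets borel \<subseteq> sets P" and "D > 0"
    and fd: "full_dimension_ineqs P D \<rho> \<gamma>\<^sub>l \<gamma>\<^sub>u x"
    and r: "0 \<le> r" "r \<le> \<rho>" and sphere: "r = \<rho> \<Longrightarrow> measure P (sphere x r) = 0"
  shows "measure P (cball x r) \<le> \<gamma>\<^sub>u x * r powr D"
proof -
  interpret prob_space P by fact
  have sets: "ball x s \<in> sets P" "cball x s \<in> sets P" for s
    by (auto intro!: subsetD[OF bs])
  have "sphere x s = cball x s - ball x s" for s by auto
  then have sphere_sets: "sphere x s \<in> sets P" for s using sets by auto
  show ?thesis
  proof (cases "r = \<rho>")
    case True
    have cball_eq: "cball x r = ball x r \<union> sphere x r" by auto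
    have "measure P (cball x r) \<le> measure P (ball x r) + measure P (sphere x r)"
      using sets sphere_sets measure_Un_le[of "ball x r" P "sphere x r"]
      by (simp add: cball_eq)
    then show ?thesis using fd sphere r True unfolding full_dimension_ineqs_def by force
  next
    case False
    \<comment> \<open>At \<open>r = 0\<close> the convergence rests on \<open>D > 0\<close> and on
      \<open>s\<close> approaching from the right.\<close>
    have "((\<lambda>s. \<gamma>\<^sub>u x * s powr D) \<longlongrightarrow> \<gamma>\<^sub>u x * r powr D) (at_right r)"
      using \<open>D > 0\<close> r by (intro tendsto_intros) (auto simp: eventually_at_filter)
    moreover have "eventually (\<lambda>s. measure P (cball x r) \<le> \<gamma>\<^sub>u x * s powr D) (at_right r)"
    proof -
      have "eventually (\<lambda>s. s \<in> {r<..<\<rho>}) (at_right r)"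
        using False r by (intro eventually_at_right_real) auto
      then show ?thesis
      proof eventually_elim
        case (elim s)
        then have "measure P (cball x r) \<le> measure P (ball x s)"
          using sets by (intro finite_measure_mono) auto
        also have "\<dots> \<le> \<gamma>\<^sub>u x * s powr D"
          using fd elim r by (simp add: full_dimension_ineqs_def)
        finally show ?case .
      qed
    qed
    ultimately show ?thesis
      by (intro tendsto_lowerbound[where F = "at_right r"]) auto
  qed
qed

section \<open>The two tail bounds for the nearest neighbour distance\<close>

text \<open>The event \<open>knn_dist \<le> r\<close> concerns closed balls, whereas the
  full-dimension inequalities control open balls of radius at most \<open>\<rho>\<close>. They leave
  the mass of the sphere of radius \<open>\<rho>\<close> open, hence the condition at
  \<open>r = \<rho>\<close> in the second bound.\<close>

theorem lemma6:
  fixes \<mu> P :: "'a::metric_space measure"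
    and D c\<^sub>D \<rho> :: real
    and S :: "'a set"
    and \<gamma>\<^sub>l \<gamma>\<^sub>u p :: "'a \<Rightarrow> real"
    and k n :: nat
    and \<Omega> :: "'w measure"
    and X :: "nat \<Rightarrow> 'w \<Rightarrow> 'a"
    and x :: 'a
  assumes "metric_measure_space \<mu>"
    and "D > 0" and "has_dimension \<mu> D c\<^sub>D \<rho>"
    and "prob_space P" and "sets P = sets \<mu>" and "absolutely_continuous \<mu> P"
    and "full_dimension_on \<mu> P D \<rho> S \<gamma>\<^sub>l \<gamma>\<^sub>u"
    and "has_density_on \<mu> P S p"
    and "1 \<le> k" and "k \<le> n"
    and "prob_space \<Omega>"
    and "prob_space.indep_vars \<Omega> (\<lambda>_. P) X {1..n}"
    and "\<And>i. i \<in> {1..n} \<Longrightarrow> distr \<Omega> P (X i) = P"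
    and "x \<in> S" and "full_dimension_ineqs P D \<rho> \<gamma>\<^sub>l \<gamma>\<^sub>u x"
  shows "(\<forall>r \<in> {(real k / (\<gamma>\<^sub>l x * real n)) powr (1 / D) .. \<rho>}.
            measure \<Omega> {\<omega> \<in> space \<Omega>. knn_dist k n (\<lambda>i. X i \<omega>) x > r}
              \<le> exp (- (\<gamma>\<^sub>l x * r powr D * real n))
                 * (exp 1 * (\<gamma>\<^sub>l x * r powr D * real n / real k)) ^ k)
       \<and> (\<forall>r \<in> {0 .. min ((real k / (\<gamma>\<^sub>u x * real n)) powr (1 / D)) \<rho>}.
            (r = \<rho> \<longrightarrow> measure P (sphere x r) = 0) \<longrightarrow>
            measure \<Omega> {\<omega> \<in> space \<Omega>. knn_dist k n (\<lambda>i. X i \<omega>) x \<le> r}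
              \<le> (exp 1 * \<gamma>\<^sub>u x * r powr D * real n / real k) powr (real k * \<gamma>\<^sub>l x / \<gamma>\<^sub>u x))"
proof -
  interpret \<Omega>: prob_space \<Omega> by fact
  interpret P: prob_space P by fact
  have bs: "sets borel \<subseteq> sets P"
    using assms(1,5) by (simp add: metric_measure_space_def metric_measure_space_axioms_def)
  have sets: "ball x s \<in> sets P" "cball x s \<in> sets P" for s
    by (auto intro!: subsetD[OF bs])
  have \<rho>: "\<rho> > 0" using assms(3) by (simp add: has_dimension_def)
  have \<gamma>: "\<gamma>\<^sub>l x > 0" "\<gamma>\<^sub>u x > 0" using assms(7,14) by (auto simp: full_dimension_on_def)
  have fd: "\<gamma>\<^sub>l x * r powr D \<le> measure P (ball x r)" "measure P (ball x r) \<le> \<gamma>\<^sub>u x * r powr D"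
    if "0 \<le> r" "r \<le> \<rho>" for r
    using assms(15) that by (auto simp: full_dimension_ineqs_def)
  \<comment> \<open>Both inequalities at the positive radius \<open>\<rho>\<close> enclose the same
    mass, which compares the two constants.\<close>
  have "\<gamma>\<^sub>l x * \<rho> powr D \<le> \<gamma>\<^sub>u x * \<rho> powr D" using fd[of \<rho>] \<rho> by linarith
  then have \<gamma>_le: "\<gamma>\<^sub>l x \<le> \<gamma>\<^sub>u x"
    by (rule mult_right_le_imp_le) (use \<rho> in simp)
  have n: "n > 0" using assms(9,10) by simp
  have distr: "measure (distr \<Omega> P (X i)) A = measure P A" if "i \<in> {1..n}" for i A
    using assms(13)[OF that] by simp
  note ind = assms(12)
  have lower: "measure \<Omega> {\<omega> \<in> space \<Omega>. knn_dist k n (\<lambda>i. X i \<omega>) x > r}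
              \<le> exp (- (\<gamma>\<^sub>l x * r powr D * real n))
                 * (exp 1 * (\<gamma>\<^sub>l x * r powr D * real n / real k)) ^ k"
    if r: "r \<in> {(real k / (\<gamma>\<^sub>l x * real n)) powr (1 / D) .. \<rho>}" for r
  proof -
    let ?s = "real k / (\<gamma>\<^sub>l x * real n)"
    have "0 < ?s powr (1 / D)" using \<gamma> n assms(9) by simp
    then have rpos: "r > 0" using r unfolding atLeastAtMost_iff by linarith
    have "?s = (?s powr (1 / D)) powr D" using \<gamma> \<open>D > 0\<close> by (simp add: powr_powr)
    also have "\<dots> \<le> r powr D" using r \<open>D > 0\<close> by (intro powr_mono2) auto
    finally have k_le: "real k \<le> \<gamma>\<^sub>l x * r powr D * real n" using \<gamma> n by (simp add: field_simps)
    \<comment> \<open>Fewer than \<open>k\<close> samples in the closed ball means fewer than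
      \<open>k\<close> in the open ball, whose mass is bounded below by \<open>fd\<close>.\<close>
    have "measure \<Omega> {\<omega> \<in> space \<Omega>. knn_dist k n (\<lambda>i. X i \<omega>) x > r}
        \<le> measure \<Omega> {\<omega> \<in> space \<Omega>. card {i\<in>{1..n}. X i \<omega> \<in> ball x r} < k}"
    proof (intro \<Omega>.finite_measure_mono \<Omega>.card_in_measurable[OF _ ind] sets subsetI CollectI conjI)
      fix \<omega> assume "\<omega> \<in> {\<omega> \<in> space \<Omega>. knn_dist k n (\<lambda>i. X i \<omega>) x > r}"
      then have "card {i\<in>{1..n}. X i \<omega> \<in> cball x r} < k"
        using knn_dist_le_iff[OF assms(9,10), of "\<lambda>i. X i \<omega>" x r] by auto
      moreover have "card {i\<in>{1..n}. X i \<omega> \<in> ball x r} \<le> card {i\<in>{1..n}. X i \<omega> \<in> cball x r}"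
        by (intro card_mono) auto
      ultimately show "card {i\<in>{1..n}. X i \<omega> \<in> ball x r} < k" by linarith
    qed auto
    also have "\<dots> \<le> exp (- (\<gamma>\<^sub>l x * r powr D * real n))
                 * (exp 1 * (\<gamma>\<^sub>l x * r powr D * real n / real k)) ^ k"
      using \<Omega>.prob_card_less_le[OF _ ind sets(1) distr, of r "\<gamma>\<^sub>l x * r powr D" k]
        k_le fd(1)[of r] rpos r \<gamma> assms(9) by simp
    finally show ?thesis .
  qed
  have upper: "measure \<Omega> {\<omega> \<in> space \<Omega>. knn_dist k n (\<lambda>i. X i \<omega>) x \<le> r}
              \<le> (exp 1 * \<gamma>\<^sub>u x * r powr D * real n / real k) powr (real k * \<gamma>\<^sub>l x / \<gamma>\<^sub>u x)"
    if r: "r \<in> {0 .. min ((real k / (\<gamma>\<^sub>u x * real n)) powr (1 / D)) \<rho>}"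
      and sphere: "r = \<rho> \<longrightarrow> measure P (sphere x r) = 0" for r
  proof -
    let ?s = "real k / (\<gamma>\<^sub>u x * real n)"
    define y where "y = exp 1 * \<gamma>\<^sub>u x * r powr D * real n / real k"
    have y: "y \<ge> 0" using \<gamma> by (simp add: y_def)
    have "r powr D \<le> (?s powr (1 / D)) powr D" using r \<open>D > 0\<close> by (intro powr_mono2) auto
    also have "\<dots> = ?s" using \<gamma> \<open>D > 0\<close> by (simp add: powr_powr)
    finally have le_k: "\<gamma>\<^sub>u x * r powr D * real n \<le> real k" using \<gamma> n by (simp add: field_simps)
    have "measure P (cball x r) \<le> \<gamma>\<^sub>u x * r powr D"
      using r sphere by (intro full_dimension_ineqs_cball_le[OF assms(4) bs assms(2,15)]) auto
    then have le: "measure \<Omega> {\<omega> \<in> space \<Omega>. knn_dist k n (\<lambda>i. X i \<omega>) x \<le> r} \<le> y ^ k"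
      using \<Omega>.prob_card_ge_le[OF _ ind sets(2) distr, of r "\<gamma>\<^sub>u x * r powr D" k] le_k assms(9)
      unfolding knn_dist_le_iff[OF assms(9,10)] y_def by (simp add: mult.assoc)
    have "measure \<Omega> {\<omega> \<in> space \<Omega>. knn_dist k n (\<lambda>i. X i \<omega>) x \<le> r} \<le> y powr (real k * \<gamma>\<^sub>l x / \<gamma>\<^sub>u x)"
    \<comment> \<open>Lowering the exponent enlarges the power only for a base at most 1; for a
      larger base the right-hand side is already at least 1.\<close>
    proof (cases "y \<le> 1")
      case True
      \<comment> \<open>The case \<open>y = 0\<close> arises from \<open>r = 0\<close>; both sides
        vanish there because \<open>k \<ge> 1\<close> and \<open>0 powr k = 0\<close>.\<close>
      have "y ^ k = y powr real k"
        using y assms(9) by (cases "y = 0") (auto simp: powr_realpow)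
      also have "\<dots> \<le> y powr (real k * \<gamma>\<^sub>l x / \<gamma>\<^sub>u x)"
        using True y \<gamma> \<gamma>_le by (intro powr_mono') (auto simp: field_simps mult_left_mono)
      finally show ?thesis using le by linarith
    next
      case False
      then have "1 \<le> y powr (real k * \<gamma>\<^sub>l x / \<gamma>\<^sub>u x)"
        using \<gamma> by (intro ge_one_powr_ge_zero) auto
      then show ?thesis using \<Omega>.prob_le_1 order_trans by blast
    qed
    then show ?thesis by (simp add: y_def)
  qed
  show ?thesis using lower upper by blast
qed

end
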